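(* Let $S$ and $T$ be monoids and let $\Gamma$ be an abelian group. The Yamazaki factorization map $$Y\colon Z^2(S\times T,\Gamma)\to Z^2(S,\Gamma)\times Z^2(T,\Gamma)\times P(S,T,\Gamma),\qquad Y(\mu)=(\mu|_S,\ \mu|_T,\ \alpha_\mu),$$ induces a well-defined bijective homomorphism of groups $$H^2(S\times T,\Gamma)\xrightarrow{\sim} H^2(S,\Gamma)\times H^2(T,\Gamma)\times P(S,T,\Gamma).$$
   Context: Monoids are written multiplicatively with identity $e$ (e.g. $e_S$, $e_T$); $\Gamma$ is an abelian group written multiplicatively, with $\frac{x}{y}=xy^{-1}$. A 2-cocycle (or cocycle) on a monoid $S$ with values in $\Gamma$ is a map $\mu\colon S\times S\to\Gamma$ with $\mu(x,yz)\mu(y,z)=\mu(x,y)\mu(xy,z)$ and $\mu(x,e)=\mu(e,x)=1$ for all $x,y,z\in S$. For a function $h\colon S\to\Gamma$ with $h(e)=1$, the coboundary of $h$ is the cocycle $\delta h(x,y)=\frac{h(x)h(y)}{h(xy)}$. $Z^2(S,\Gamma)$ is the abelian group of cocycles under pointwise multiplication, $B^2(S,\Gamma)$ the subgroup of coboundaries, and $H^2(S,\Gamma)=Z^2(S,\Gamma)/B^2(S,\Gamma)$. In the direct product $S\times T$, $S$ is identified with the submonoid $S\times\{e_T\}$ and $T$ with $\{e_S\}\times T$; $\mu|_S$, $\mu|_T$ denote the restrictions of a cocycle $\mu$ on $S\times T$ to these submonoids. $P(S,T,\Gamma)$ is the group, under pointwise multiplication, of bimultiplicative pairings, i.e. maps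 $\alpha\colon S\times T\to\Gamma$ with $\alpha(ss',t)=\alpha(s,t)\alpha(s',t)$ and $\alpha(s,tt')=\alpha(s,t)\alpha(s,t')$ for all $s,s'\in S$, $t,t'\in T$. For a cocycle $\mu$ on $S\times T$, $\alpha_\mu(s,t)=\frac{\mu(s,t)}{\mu(t,s)}=\frac{\mu((s,e_T),(e_S,t))}{\mu((e_S,t),(s,e_T))}$ for $s\in S$, $t\in T$; this $\alpha_\mu$ belongs to $P(S,T,\Gamma)$. The induced map on $H^2$ sends the class of $\mu$ to (class of $\mu|_S$, class of $\mu|_T$, $\alpha_\mu$). *)

theory Defs
  imports "HOL-Algebra.Product_Groups" "HOL-Algebra.Coset"
begin

(* Maps on S x S with values in Gamma are represented by functions on pairs that are
   undefined outside carrier S x carrier S, so that equality of functions is equality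
   of maps. Pointwise multiplication is that of the library's product_group. *)

definition cocycles ::
    "('a, 'm) monoid_scheme \<Rightarrow> ('g, 'n) monoid_scheme \<Rightarrow> ('a \<times> 'a \<Rightarrow> 'g) set" where
  "cocycles S \<Gamma> = {\<mu> \<in> (carrier S \<times> carrier S) \<rightarrow>\<^sub>E carrier \<Gamma>.
     (\<forall>x\<in>carrier S. \<forall>y\<in>carrier S. \<forall>z\<in>carrier S.
        \<mu> (x, y \<otimes>\<^bsub>S\<^esub> z) \<otimes>\<^bsub>\<Gamma>\<^esub> \<mu> (y, z) = \<mu> (x, y) \<otimes>\<^bsub>\<Gamma>\<^esub> \<mu> (x \<otimes>\<^bsub>S\<^esub> y, z)) \<and>
     (\<forall>x\<in>carrier S. \<mu> (x, \<one>\<^bsub>S\<^esub>) = \<one>\<^bsub>\<Gamma>\<^esub> \<and> \<mu> (\<one>\<^bsub>S\<^esub>, x) = \<one>\<^bsub>\<Gamma>\<^esub>)}"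

definition Z2 ::
    "('a, 'm) monoid_scheme \<Rightarrow> ('g, 'n) monoid_scheme \<Rightarrow> ('a \<times> 'a \<Rightarrow> 'g) monoid" where
  "Z2 S \<Gamma> = (product_group (carrier S \<times> carrier S) (\<lambda>_. \<Gamma>))\<lparr>carrier := cocycles S \<Gamma>\<rparr>"

definition coboundary ::
    "('a, 'm) monoid_scheme \<Rightarrow> ('g, 'n) monoid_scheme \<Rightarrow> ('a \<Rightarrow> 'g) \<Rightarrow> 'a \<times> 'a \<Rightarrow> 'g" where
  "coboundary S \<Gamma> h =
     (\<lambda>(x, y)\<in>carrier S \<times> carrier S. (h x \<otimes>\<^bsub>\<Gamma>\<^esub> h y) \<otimes>\<^bsub>\<Gamma>\<^esub> inv\<^bsub>\<Gamma>\<^esub> (h (x \<otimes>\<^bsub>S\<^esub> y)))"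

definition B2 ::
    "('a, 'm) monoid_scheme \<Rightarrow> ('g, 'n) monoid_scheme \<Rightarrow> ('a \<times> 'a \<Rightarrow> 'g) set" where
  "B2 S \<Gamma> = {coboundary S \<Gamma> h |h. h \<in> carrier S \<rightarrow> carrier \<Gamma> \<and> h \<one>\<^bsub>S\<^esub> = \<one>\<^bsub>\<Gamma>\<^esub>}"

definition H2 ::
    "('a, 'm) monoid_scheme \<Rightarrow> ('g, 'n) monoid_scheme \<Rightarrow> ('a \<times> 'a \<Rightarrow> 'g) set monoid" where
  "H2 S \<Gamma> = Z2 S \<Gamma> Mod B2 S \<Gamma>"

definition H2_class ::
    "('a, 'm) monoid_scheme \<Rightarrow> ('g, 'n) monoid_scheme \<Rightarrow> ('a \<times> 'a \<Rightarrow> 'g) \<Rightarrow> ('a \<times> 'a \<Rightarrow> 'g) set" where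
  "H2_class S \<Gamma> \<mu> = B2 S \<Gamma> #>\<^bsub>Z2 S \<Gamma>\<^esub> \<mu>"

definition pairings ::
    "('a, 'm) monoid_scheme \<Rightarrow> ('b, 'k) monoid_scheme \<Rightarrow> ('g, 'n) monoid_scheme
       \<Rightarrow> ('a \<times> 'b \<Rightarrow> 'g) set" where
  "pairings S T \<Gamma> = {\<alpha> \<in> (carrier S \<times> carrier T) \<rightarrow>\<^sub>E carrier \<Gamma>.
     (\<forall>s\<in>carrier S. \<forall>s'\<in>carrier S. \<forall>t\<in>carrier T.
        \<alpha> (s \<otimes>\<^bsub>S\<^esub> s', t) = \<alpha> (s, t) \<otimes>\<^bsub>\<Gamma>\<^esub> \<alpha> (s', t)) \<and>
     (\<forall>s\<in>carrier S. \<forall>t\<in>carrier T. \<forall>t'\<in>carrier T.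
        \<alpha> (s, t \<otimes>\<^bsub>T\<^esub> t') = \<alpha> (s, t) \<otimes>\<^bsub>\<Gamma>\<^esub> \<alpha> (s, t'))}"

definition pairing_group ::
    "('a, 'm) monoid_scheme \<Rightarrow> ('b, 'k) monoid_scheme \<Rightarrow> ('g, 'n) monoid_scheme
       \<Rightarrow> ('a \<times> 'b \<Rightarrow> 'g) monoid" where
  "pairing_group S T \<Gamma> =
     (product_group (carrier S \<times> carrier T) (\<lambda>_. \<Gamma>))\<lparr>carrier := pairings S T \<Gamma>\<rparr>"

definition restrict_left ::
    "('a, 'm) monoid_scheme \<Rightarrow> ('b, 'k) monoid_scheme
       \<Rightarrow> (('a \<times> 'b) \<times> ('a \<times> 'b) \<Rightarrow> 'g) \<Rightarrow> 'a \<times> 'a \<Rightarrow> 'g" where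
  "restrict_left S T \<mu> =
     (\<lambda>(x, y)\<in>carrier S \<times> carrier S. \<mu> ((x, \<one>\<^bsub>T\<^esub>), (y, \<one>\<^bsub>T\<^esub>)))"

definition restrict_right ::
    "('a, 'm) monoid_scheme \<Rightarrow> ('b, 'k) monoid_scheme
       \<Rightarrow> (('a \<times> 'b) \<times> ('a \<times> 'b) \<Rightarrow> 'g) \<Rightarrow> 'b \<times> 'b \<Rightarrow> 'g" where
  "restrict_right S T \<mu> =
     (\<lambda>(x, y)\<in>carrier T \<times> carrier T. \<mu> ((\<one>\<^bsub>S\<^esub>, x), (\<one>\<^bsub>S\<^esub>, y)))"

definition assoc_pairing ::
    "('a, 'm) monoid_scheme \<Rightarrow> ('b, 'k) monoid_scheme \<Rightarrow> ('g, 'n) monoid_scheme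
       \<Rightarrow> (('a \<times> 'b) \<times> ('a \<times> 'b) \<Rightarrow> 'g) \<Rightarrow> 'a \<times> 'b \<Rightarrow> 'g" where
  "assoc_pairing S T \<Gamma> \<mu> =
     (\<lambda>(s, t)\<in>carrier S \<times> carrier T.
        \<mu> ((s, \<one>\<^bsub>T\<^esub>), (\<one>\<^bsub>S\<^esub>, t)) \<otimes>\<^bsub>\<Gamma>\<^esub> inv\<^bsub>\<Gamma>\<^esub> (\<mu> ((\<one>\<^bsub>S\<^esub>, t), (s, \<one>\<^bsub>T\<^esub>))))"

definition yamazaki ::
    "('a, 'm) monoid_scheme \<Rightarrow> ('b, 'k) monoid_scheme \<Rightarrow> ('g, 'n) monoid_scheme
       \<Rightarrow> (('a \<times> 'b) \<times> ('a \<times> 'b) \<Rightarrow> 'g)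
       \<Rightarrow> ('a \<times> 'a \<Rightarrow> 'g) \<times> ('b \<times> 'b \<Rightarrow> 'g) \<times> ('a \<times> 'b \<Rightarrow> 'g)" where
  "yamazaki S T \<Gamma> \<mu> = (restrict_left S T \<mu>, restrict_right S T \<mu>, assoc_pairing S T \<Gamma> \<mu>)"


text \<open>The library's \<open>Mod\<close> is only meaningful for a normal subgroup, so we check
  that the objects above are indeed groups.\<close>

lemma comm_group_maps:
  assumes "comm_group \<Gamma>"
  shows "comm_group (product_group I (\<lambda>_. \<Gamma>))"
proof -
  interpret comm_group \<Gamma> by fact
  show ?thesis
    by (rule group.group_comm_groupI)
       (auto simp: is_group m_comm PiE_iff intro!: restrict_ext)
qed

lemma comm_group_subgroup:
  assumes "comm_group G" "subgroup H G"
  shows "comm_group (G\<lparr>carrier := H\<rparr>)"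
proof -
  interpret comm_group G by fact
  show ?thesis
    using subgroup.subgroup_is_group[OF assms(2) is_group] subgroup.subset[OF assms(2)]
    by (intro group.group_comm_groupI) (auto intro!: m_comm)
qed

lemma subgroup_cocycles:
  assumes "monoid S" "comm_group \<Gamma>"
  shows "subgroup (cocycles S \<Gamma>) (product_group (carrier S \<times> carrier S) (\<lambda>_. \<Gamma>))"
proof -
  interpret S: monoid S by fact
  interpret comm_group \<Gamma> by fact
  let ?M = "product_group (carrier S \<times> carrier S) (\<lambda>_. \<Gamma>)"
  have closed: "\<mu> (x, y) \<in> carrier \<Gamma>"
    if "\<mu> \<in> cocycles S \<Gamma>" "x \<in> carrier S" "y \<in> carrier S" for \<mu> x y
    using that by (auto simp: cocycles_def)
  have coc: "\<mu> (x, y \<otimes>\<^bsub>S\<^esub> z) \<otimes>\<^bsub>\<Gamma>\<^esub> \<mu> (y, z) = \<mu> (x, y) \<otimes>\<^bsub>\<Gamma>\<^esub> \<mu> (x \<otimes>\<^bsub>S\<^esub> y, z)"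
    if "\<mu> \<in> cocycles S \<Gamma>" "x \<in> carrier S" "y \<in> carrier S" "z \<in> carrier S" for \<mu> x y z
    using that by (auto simp: cocycles_def)
  show ?thesis
  proof (rule group.subgroupI)
    show "group ?M"
      by (simp add: is_group)
    show "cocycles S \<Gamma> \<subseteq> carrier ?M"
      by (auto simp: cocycles_def)
    have "\<one>\<^bsub>?M\<^esub> \<in> cocycles S \<Gamma>"
      by (auto simp: cocycles_def)
    then show "cocycles S \<Gamma> \<noteq> {}"
      by blast
  next
    fix \<mu> assume \<mu>: "\<mu> \<in> cocycles S \<Gamma>"
    then have "inv\<^bsub>?M\<^esub> \<mu> = (\<lambda>i\<in>carrier S \<times> carrier S. inv\<^bsub>\<Gamma>\<^esub> \<mu> i)"
      by (intro inv_product_group) (auto simp: cocycles_def is_group)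
    moreover have "inv\<^bsub>\<Gamma>\<^esub> \<mu> (x, y \<otimes>\<^bsub>S\<^esub> z) \<otimes>\<^bsub>\<Gamma>\<^esub> inv\<^bsub>\<Gamma>\<^esub> \<mu> (y, z)
        = inv\<^bsub>\<Gamma>\<^esub> \<mu> (x, y) \<otimes>\<^bsub>\<Gamma>\<^esub> inv\<^bsub>\<Gamma>\<^esub> \<mu> (x \<otimes>\<^bsub>S\<^esub> y, z)"
      if "x \<in> carrier S" "y \<in> carrier S" "z \<in> carrier S" for x y z
      using that coc[OF \<mu> that] closed[OF \<mu>]
      by (simp flip: inv_mult)
    ultimately show "inv\<^bsub>?M\<^esub> \<mu> \<in> cocycles S \<Gamma>"
      using \<mu> by (auto simp: cocycles_def)
  next
    fix \<mu> \<nu> assume \<mu>: "\<mu> \<in> cocycles S \<Gamma>" and \<nu>: "\<nu> \<in> cocycles S \<Gamma>"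
    have "(\<mu> (x, y \<otimes>\<^bsub>S\<^esub> z) \<otimes>\<^bsub>\<Gamma>\<^esub> \<nu> (x, y \<otimes>\<^bsub>S\<^esub> z)) \<otimes>\<^bsub>\<Gamma>\<^esub> (\<mu> (y, z) \<otimes>\<^bsub>\<Gamma>\<^esub> \<nu> (y, z))
        = (\<mu> (x, y) \<otimes>\<^bsub>\<Gamma>\<^esub> \<nu> (x, y)) \<otimes>\<^bsub>\<Gamma>\<^esub> (\<mu> (x \<otimes>\<^bsub>S\<^esub> y, z) \<otimes>\<^bsub>\<Gamma>\<^esub> \<nu> (x \<otimes>\<^bsub>S\<^esub> y, z))"
      (is "?l = ?r") if "x \<in> carrier S" "y \<in> carrier S" "z \<in> carrier S" for x y z
    proof -
      have "?l = (\<mu> (x, y \<otimes>\<^bsub>S\<^esub> z) \<otimes>\<^bsub>\<Gamma>\<^esub> \<mu> (y, z)) \<otimes>\<^bsub>\<Gamma>\<^esub> (\<nu> (x, y \<otimes>\<^bsub>S\<^esub> z) \<otimes>\<^bsub>\<Gamma>\<^esub> \<nu> (y, z))"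
        using that closed[OF \<mu>] closed[OF \<nu>] by (simp add: m_ac)
      also have "\<dots> = ?r"
        using that closed[OF \<mu>] closed[OF \<nu>] by (simp add: coc[OF \<mu> that] coc[OF \<nu> that] m_ac)
      finally show ?thesis .
    qed
    then show "\<mu> \<otimes>\<^bsub>?M\<^esub> \<nu> \<in> cocycles S \<Gamma>"
      using \<mu> \<nu> by (auto simp: cocycles_def)
  qed
qed

lemma comm_group_Z2:
  assumes "monoid S" "comm_group \<Gamma>"
  shows "comm_group (Z2 S \<Gamma>)"
  unfolding Z2_def using assms
  by (intro comm_group_subgroup comm_group_maps subgroup_cocycles)

lemma comm_group_pairing_group:
  assumes "monoid S" "monoid T" "comm_group \<Gamma>"
  shows "comm_group (pairing_group S T \<Gamma>)"
proof -
  interpret S: monoid S by fact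
  interpret T: monoid T by fact
  interpret comm_group \<Gamma> by fact
  let ?M = "product_group (carrier S \<times> carrier T) (\<lambda>_. \<Gamma>)"
  have closed: "\<alpha> (s, t) \<in> carrier \<Gamma>"
    if "\<alpha> \<in> pairings S T \<Gamma>" "s \<in> carrier S" "t \<in> carrier T" for \<alpha> s t
    using that by (auto simp: pairings_def)
  have "subgroup (pairings S T \<Gamma>) ?M"
  proof (rule group.subgroupI)
    show "group ?M"
      by (simp add: is_group)
    show "pairings S T \<Gamma> \<subseteq> carrier ?M"
      by (auto simp: pairings_def)
    have "\<one>\<^bsub>?M\<^esub> \<in> pairings S T \<Gamma>"
      by (auto simp: pairings_def)
    then show "pairings S T \<Gamma> \<noteq> {}"
      by blast
  next
    fix \<alpha> assume \<alpha>: "\<alpha> \<in> pairings S T \<Gamma>"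
    then have "inv\<^bsub>?M\<^esub> \<alpha> = (\<lambda>i\<in>carrier S \<times> carrier T. inv\<^bsub>\<Gamma>\<^esub> \<alpha> i)"
      by (intro inv_product_group) (auto simp: pairings_def is_group)
    then show "inv\<^bsub>?M\<^esub> \<alpha> \<in> pairings S T \<Gamma>"
      using \<alpha> closed[OF \<alpha>] by (auto simp: pairings_def inv_mult)
  next
    fix \<alpha> \<beta> assume "\<alpha> \<in> pairings S T \<Gamma>" "\<beta> \<in> pairings S T \<Gamma>"
    then show "\<alpha> \<otimes>\<^bsub>?M\<^esub> \<beta> \<in> pairings S T \<Gamma>"
      using closed[of \<alpha>] closed[of \<beta>] by (auto simp: pairings_def m_ac)
  qed
  then show ?thesis
    unfolding pairing_group_def
    by (intro comm_group_subgroup comm_group_maps assms)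
qed

lemma coboundary_in_cocycles:
  assumes "monoid S" "comm_group \<Gamma>" "h \<in> carrier S \<rightarrow> carrier \<Gamma>" "h \<one>\<^bsub>S\<^esub> = \<one>\<^bsub>\<Gamma>\<^esub>"
  shows "coboundary S \<Gamma> h \<in> cocycles S \<Gamma>"
proof -
  interpret S: monoid S by fact
  interpret comm_group \<Gamma> by fact
  have h: "h x \<in> carrier \<Gamma>" if "x \<in> carrier S" for x
    using that assms(3) by auto
  have cancel: "(a \<otimes>\<^bsub>\<Gamma>\<^esub> d \<otimes>\<^bsub>\<Gamma>\<^esub> inv\<^bsub>\<Gamma>\<^esub> u) \<otimes>\<^bsub>\<Gamma>\<^esub> (b \<otimes>\<^bsub>\<Gamma>\<^esub> c \<otimes>\<^bsub>\<Gamma>\<^esub> inv\<^bsub>\<Gamma>\<^esub> d)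
      = a \<otimes>\<^bsub>\<Gamma>\<^esub> b \<otimes>\<^bsub>\<Gamma>\<^esub> c \<otimes>\<^bsub>\<Gamma>\<^esub> inv\<^bsub>\<Gamma>\<^esub> u"
    if "a \<in> carrier \<Gamma>" "b \<in> carrier \<Gamma>" "c \<in> carrier \<Gamma>" "d \<in> carrier \<Gamma>" "u \<in> carrier \<Gamma>"
    for a b c d u
  proof -
    have "d \<otimes>\<^bsub>\<Gamma>\<^esub> (inv\<^bsub>\<Gamma>\<^esub> d \<otimes>\<^bsub>\<Gamma>\<^esub> inv\<^bsub>\<Gamma>\<^esub> u) = inv\<^bsub>\<Gamma>\<^esub> u"
      using that by (simp flip: m_assoc)
    then show ?thesis
      using that by (simp add: m_ac)
  qed
  have "(h x \<otimes>\<^bsub>\<Gamma>\<^esub> h (y \<otimes>\<^bsub>S\<^esub> z) \<otimes>\<^bsub>\<Gamma>\<^esub> inv\<^bsub>\<Gamma>\<^esub> h (x \<otimes>\<^bsub>S\<^esub> (y \<otimes>\<^bsub>S\<^esub> z)))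
          \<otimes>\<^bsub>\<Gamma>\<^esub> (h y \<otimes>\<^bsub>\<Gamma>\<^esub> h z \<otimes>\<^bsub>\<Gamma>\<^esub> inv\<^bsub>\<Gamma>\<^esub> h (y \<otimes>\<^bsub>S\<^esub> z))
      = (h x \<otimes>\<^bsub>\<Gamma>\<^esub> h y \<otimes>\<^bsub>\<Gamma>\<^esub> inv\<^bsub>\<Gamma>\<^esub> h (x \<otimes>\<^bsub>S\<^esub> y))
          \<otimes>\<^bsub>\<Gamma>\<^esub> (h (x \<otimes>\<^bsub>S\<^esub> y) \<otimes>\<^bsub>\<Gamma>\<^esub> h z \<otimes>\<^bsub>\<Gamma>\<^esub> inv\<^bsub>\<Gamma>\<^esub> h (x \<otimes>\<^bsub>S\<^esub> y \<otimes>\<^bsub>S\<^esub> z))"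
    (is "?l = ?r") if "x \<in> carrier S" "y \<in> carrier S" "z \<in> carrier S" for x y z
  proof -
    let ?u = "h (x \<otimes>\<^bsub>S\<^esub> y \<otimes>\<^bsub>S\<^esub> z)"
    have "?l = h x \<otimes>\<^bsub>\<Gamma>\<^esub> h y \<otimes>\<^bsub>\<Gamma>\<^esub> h z \<otimes>\<^bsub>\<Gamma>\<^esub> inv\<^bsub>\<Gamma>\<^esub> ?u"
      using that cancel[of "h x" "h y" "h z" "h (y \<otimes>\<^bsub>S\<^esub> z)" ?u] by (simp add: h S.m_assoc)
    moreover have "?r = h z \<otimes>\<^bsub>\<Gamma>\<^esub> h x \<otimes>\<^bsub>\<Gamma>\<^esub> h y \<otimes>\<^bsub>\<Gamma>\<^esub> inv\<^bsub>\<Gamma>\<^esub> ?u"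
      using that cancel[of "h z" "h x" "h y" "h (x \<otimes>\<^bsub>S\<^esub> y)" ?u] by (simp add: h m_ac)
    ultimately show ?thesis
      using that by (simp add: h m_ac)
  qed
  then show ?thesis
    using h assms(4) by (auto simp: cocycles_def coboundary_def)
qed

lemma subgroup_B2:
  assumes "monoid S" "comm_group \<Gamma>"
  shows "subgroup (B2 S \<Gamma>) (Z2 S \<Gamma>)"
proof -
  interpret S: monoid S by fact
  interpret comm_group \<Gamma> by fact
  interpret Z: comm_group "Z2 S \<Gamma>" by (rule comm_group_Z2[OF assms])
  let ?M = "product_group (carrier S \<times> carrier S) (\<lambda>_. \<Gamma>)"
  show ?thesis
  proof (rule Z.subgroupI)
    show "B2 S \<Gamma> \<subseteq> carrier (Z2 S \<Gamma>)"
      using coboundary_in_cocycles[OF assms] by (auto simp: B2_def Z2_def)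
    show "B2 S \<Gamma> \<noteq> {}"
      by (auto simp: B2_def intro!: exI[of _ "\<lambda>_. \<one>\<^bsub>\<Gamma>\<^esub>"])
  next
    fix b assume "b \<in> B2 S \<Gamma>"
    then obtain h where h: "h \<in> carrier S \<rightarrow> carrier \<Gamma>" "h \<one>\<^bsub>S\<^esub> = \<one>\<^bsub>\<Gamma>\<^esub>"
      and b: "b = coboundary S \<Gamma> h"
      by (auto simp: B2_def)
    have bZ: "b \<in> cocycles S \<Gamma>"
      using coboundary_in_cocycles[OF assms h] b by simp
    have hc: "h x \<in> carrier \<Gamma>" if "x \<in> carrier S" for x
      using that h by auto
    have "inv\<^bsub>Z2 S \<Gamma>\<^esub> b = inv\<^bsub>?M\<^esub> b"
      unfolding Z2_def
      by (rule group.m_inv_consistent[OF _ subgroup_cocycles[OF assms] bZ])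
         (simp add: is_group)
    also have "\<dots> = (\<lambda>i\<in>carrier S \<times> carrier S. inv\<^bsub>\<Gamma>\<^esub> b i)"
      using bZ by (intro inv_product_group) (auto simp: cocycles_def is_group)
    also have "\<dots> = coboundary S \<Gamma> (\<lambda>x. inv\<^bsub>\<Gamma>\<^esub> h x)"
      unfolding b coboundary_def by (rule restrict_ext) (auto simp: hc inv_mult)
    finally show "inv\<^bsub>Z2 S \<Gamma>\<^esub> b \<in> B2 S \<Gamma>"
      using hc h(2) by (auto simp: B2_def intro!: exI[of _ "\<lambda>x. inv\<^bsub>\<Gamma>\<^esub> h x"])
  next
    fix b c assume "b \<in> B2 S \<Gamma>" "c \<in> B2 S \<Gamma>"
    then obtain h k where h: "h \<in> carrier S \<rightarrow> carrier \<Gamma>" "h \<one>\<^bsub>S\<^esub> = \<one>\<^bsub>\<Gamma>\<^esub>"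
      and b: "b = coboundary S \<Gamma> h"
      and k: "k \<in> carrier S \<rightarrow> carrier \<Gamma>" "k \<one>\<^bsub>S\<^esub> = \<one>\<^bsub>\<Gamma>\<^esub>"
      and c: "c = coboundary S \<Gamma> k"
      by (auto simp: B2_def)
    have hc: "h x \<in> carrier \<Gamma>" "k x \<in> carrier \<Gamma>" if "x \<in> carrier S" for x
      using that h k by auto
    have "b \<otimes>\<^bsub>Z2 S \<Gamma>\<^esub> c = coboundary S \<Gamma> (\<lambda>x. h x \<otimes>\<^bsub>\<Gamma>\<^esub> k x)"
      unfolding b c coboundary_def Z2_def
      by (simp, rule restrict_ext) (auto simp: hc inv_mult m_ac)
    then show "b \<otimes>\<^bsub>Z2 S \<Gamma>\<^esub> c \<in> B2 S \<Gamma>"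
      using hc h(2) k(2) by (auto simp: B2_def intro!: exI[of _ "\<lambda>x. h x \<otimes>\<^bsub>\<Gamma>\<^esub> k x"])
  qed
qed

lemma comm_group_H2:
  assumes "monoid S" "comm_group \<Gamma>"
  shows "comm_group (H2 S \<Gamma>)"
  unfolding H2_def
  by (rule comm_group.abelian_FactGroup[OF comm_group_Z2[OF assms] subgroup_B2[OF assms]])

end

theory Submission
  imports Defs
begin

text \<open>Write \<open>c (s, t) = \<mu> (s, t)\<close>. Four instances of the cocycle identity express \<open>\<mu>\<close> on all of
  \<open>S \<times> T\<close> through its Yamazaki factors,
  \<open>\<mu> (st, s't') = \<mu> (s, s') \<mu> (t, t') \<alpha> (s', t)\<inverse> c (ss', tt') / (c (s, t) c (s', t'))\<close>.
  Hence if \<open>\<mu>|S = \<delta> f\<close>, \<open>\<mu>|T = \<delta> g\<close> and \<open>\<alpha> = 1\<close>, then \<open>\<mu> = \<delta> (f g / c)\<close>, so the induced map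
  is injective. It is surjective because
  \<open>(st, s't') \<mapsto> \<sigma> (s, s') \<tau> (t, t') \<alpha> (s, t')\<close> is a cocycle with factors \<open>\<sigma>\<close>, \<open>\<tau>\<close>, \<open>\<alpha>\<close>.\<close>

section \<open>Pointwise rules for cocycles and pairings\<close>

lemma carrier_Z2 [simp]: "carrier (Z2 S \<Gamma>) = cocycles S \<Gamma>"
  by (simp add: Z2_def)

lemma mult_Z2:
  "\<mu> \<otimes>\<^bsub>Z2 S \<Gamma>\<^esub> \<nu> = (\<lambda>p\<in>carrier S \<times> carrier S. \<mu> p \<otimes>\<^bsub>\<Gamma>\<^esub> \<nu> p)"
  by (simp add: Z2_def)

lemma carrier_pairing_group [simp]: "carrier (pairing_group S T \<Gamma>) = pairings S T \<Gamma>"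
  by (simp add: pairing_group_def)

lemma mult_pairing_group:
  "\<alpha> \<otimes>\<^bsub>pairing_group S T \<Gamma>\<^esub> \<beta> = (\<lambda>p\<in>carrier S \<times> carrier T. \<alpha> p \<otimes>\<^bsub>\<Gamma>\<^esub> \<beta> p)"
  by (simp add: pairing_group_def)

lemma one_pairing_group:
  "\<one>\<^bsub>pairing_group S T \<Gamma>\<^esub> = (\<lambda>p\<in>carrier S \<times> carrier T. \<one>\<^bsub>\<Gamma>\<^esub>)"
  by (simp add: pairing_group_def)

lemma cocycle_closed:
  assumes "\<mu> \<in> cocycles S \<Gamma>" "x \<in> carrier S" "y \<in> carrier S"
  shows "\<mu> (x, y) \<in> carrier \<Gamma>"
  using assms by (auto simp: cocycles_def)

lemma cocycle_identity:
  assumes "\<mu> \<in> cocycles S \<Gamma>" "x \<in> carrier S" "y \<in> carrier S" "z \<in> carrier S"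
  shows "\<mu> (x, y \<otimes>\<^bsub>S\<^esub> z) \<otimes>\<^bsub>\<Gamma>\<^esub> \<mu> (y, z) = \<mu> (x, y) \<otimes>\<^bsub>\<Gamma>\<^esub> \<mu> (x \<otimes>\<^bsub>S\<^esub> y, z)"
  using assms by (auto simp: cocycles_def)

lemma cocycle_one:
  assumes "\<mu> \<in> cocycles S \<Gamma>" "x \<in> carrier S"
  shows "\<mu> (x, \<one>\<^bsub>S\<^esub>) = \<one>\<^bsub>\<Gamma>\<^esub>" "\<mu> (\<one>\<^bsub>S\<^esub>, x) = \<one>\<^bsub>\<Gamma>\<^esub>"
  using assms by (auto simp: cocycles_def)

text \<open>Members of \<open>cocycles\<close> are \<open>undefined\<close> off the carrier, so
  their values on the carrier decide equality.\<close>

lemma cocycle_ext: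
  assumes "\<mu> \<in> cocycles S \<Gamma>" "\<nu> \<in> cocycles S \<Gamma>"
    and "\<And>x y. \<lbrakk>x \<in> carrier S; y \<in> carrier S\<rbrakk> \<Longrightarrow> \<mu> (x, y) = \<nu> (x, y)"
  shows "\<mu> = \<nu>"
  by (rule PiE_ext[of _ "carrier S \<times> carrier S" "\<lambda>_. carrier \<Gamma>"])
     (use assms in \<open>auto simp: cocycles_def\<close>)

lemma pairing_closed:
  assumes "\<alpha> \<in> pairings S T \<Gamma>" "s \<in> carrier S" "t \<in> carrier T"
  shows "\<alpha> (s, t) \<in> carrier \<Gamma>"
  using assms by (auto simp: pairings_def)

lemma pairing_mult:
  assumes "\<alpha> \<in> pairings S T \<Gamma>"
  shows "\<lbrakk>s \<in> carrier S; s' \<in> carrier S; t \<in> carrier T\<rbrakk>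
      \<Longrightarrow> \<alpha> (s \<otimes>\<^bsub>S\<^esub> s', t) = \<alpha> (s, t) \<otimes>\<^bsub>\<Gamma>\<^esub> \<alpha> (s', t)"
    and "\<lbrakk>s \<in> carrier S; t \<in> carrier T; t' \<in> carrier T\<rbrakk>
      \<Longrightarrow> \<alpha> (s, t \<otimes>\<^bsub>T\<^esub> t') = \<alpha> (s, t) \<otimes>\<^bsub>\<Gamma>\<^esub> \<alpha> (s, t')"
  using assms by (auto simp: pairings_def)

text \<open>Bimultiplicativity makes these values idempotent, and the only idempotent of a group is
  its identity.\<close>

lemma pairing_one:
  assumes "monoid S" "monoid T" "group \<Gamma>" "\<alpha> \<in> pairings S T \<Gamma>"
  shows "t \<in> carrier T \<Longrightarrow> \<alpha> (\<one>\<^bsub>S\<^esub>, t) = \<one>\<^bsub>\<Gamma>\<^esub>"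
    and "s \<in> carrier S \<Longrightarrow> \<alpha> (s, \<one>\<^bsub>T\<^esub>) = \<one>\<^bsub>\<Gamma>\<^esub>"
proof -
  interpret S: monoid S by fact
  interpret T: monoid T by fact
  interpret group \<Gamma> by fact
  note closed = pairing_closed[OF assms(4)]
  show "\<alpha> (\<one>\<^bsub>S\<^esub>, t) = \<one>\<^bsub>\<Gamma>\<^esub>" if "t \<in> carrier T"
    using pairing_mult(1)[OF assms(4), of "\<one>\<^bsub>S\<^esub>" "\<one>\<^bsub>S\<^esub>" t] that
    by (simp add: closed)
  show "\<alpha> (s, \<one>\<^bsub>T\<^esub>) = \<one>\<^bsub>\<Gamma>\<^esub>" if "s \<in> carrier S"
    using pairing_mult(2)[OF assms(4), of s "\<one>\<^bsub>T\<^esub>" "\<one>\<^bsub>T\<^esub>"] that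
    by (simp add: closed)
qed

section \<open>Pullback of cocycles along monoid homomorphisms\<close>

definition pullback ::
    "('a, 'm) monoid_scheme \<Rightarrow> ('a \<Rightarrow> 'b) \<Rightarrow> ('b \<times> 'b \<Rightarrow> 'g) \<Rightarrow> 'a \<times> 'a \<Rightarrow> 'g" where
  "pullback S \<phi> \<mu> = (\<lambda>(x, y)\<in>carrier S \<times> carrier S. \<mu> (\<phi> x, \<phi> y))"

lemma pullback_apply [simp]:
  "\<lbrakk>x \<in> carrier S; y \<in> carrier S\<rbrakk> \<Longrightarrow> pullback S \<phi> \<mu> (x, y) = \<mu> (\<phi> x, \<phi> y)"
  by (simp add: pullback_def)

text \<open>Inclusions into \<open>S \<times>\<times> T\<close> give the restrictions of a cocycle,
  projections give the preimages for surjectivity. For monoids \<open>hom\<close> does not force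
  preservation of the identity, on which normalization of the pullback rests; hence the separate
  assumption.\<close>

lemma pullback_cocycle:
  assumes "monoid S" "\<phi> \<in> hom S U" "\<phi> \<one>\<^bsub>S\<^esub> = \<one>\<^bsub>U\<^esub>" "\<mu> \<in> cocycles U \<Gamma>"
  shows "pullback S \<phi> \<mu> \<in> cocycles S \<Gamma>"
proof -
  interpret S: monoid S by fact
  have \<phi>: "\<phi> x \<in> carrier U" if "x \<in> carrier S" for x
    using assms(2) that by (rule hom_in_carrier)
  show ?thesis
    unfolding cocycles_def
    by (auto simp: pullback_def \<phi> hom_mult[OF assms(2)] assms(3)
        cocycle_closed[OF assms(4)] cocycle_identity[OF assms(4)] cocycle_one[OF assms(4)])
qed

lemma pullback_hom:
  assumes "monoid S" "\<phi> \<in> hom S U" "\<phi> \<one>\<^bsub>S\<^esub> = \<one>\<^bsub>U\<^esub>"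
  shows "pullback S \<phi> \<in> hom (Z2 U \<Gamma>) (Z2 S \<Gamma>)"
  using hom_in_carrier[OF assms(2)] pullback_cocycle[OF assms]
  by (intro homI) (auto simp: mult_Z2 pullback_def intro!: restrict_ext)

text \<open>The pullback of the coboundary of \<open>h\<close> is the coboundary of
  \<open>h \<circ> \<phi>\<close>; this lets restriction descend to cohomology classes.\<close>

lemma pullback_coboundary:
  assumes "monoid S" "\<phi> \<in> hom S U" "\<phi> \<one>\<^bsub>S\<^esub> = \<one>\<^bsub>U\<^esub>" "b \<in> B2 U \<Gamma>"
  shows "pullback S \<phi> b \<in> B2 S \<Gamma>"
proof -
  obtain h where h: "h \<in> carrier U \<rightarrow> carrier \<Gamma>" "h \<one>\<^bsub>U\<^esub> = \<one>\<^bsub>\<Gamma>\<^esub>" and b: "b = coboundary U \<Gamma> h"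
    using assms(4) by (auto simp: B2_def)
  note \<phi> = hom_in_carrier[OF assms(2)]
  have "pullback S \<phi> b = coboundary S \<Gamma> (h \<circ> \<phi>)"
    unfolding b pullback_def coboundary_def
    by (rule restrict_ext) (auto simp: \<phi> hom_mult[OF assms(2)])
  moreover have "h \<circ> \<phi> \<in> carrier S \<rightarrow> carrier \<Gamma>"
    using \<phi> h(1) by auto
  ultimately show ?thesis
    using h(2) assms(3) unfolding B2_def by force
qed

section \<open>Auxiliary facts about groups\<close>

text \<open>Multiplicativity of \<open>\<alpha>\<close> in one argument has the shape v/k =
  (c/d)(a/b). Clearing denominators leaves an equation without inverses, which instances of the
  cocycle identity can prove.\<close>

lemma (in comm_group) divide_eq_mult_divide:
  assumes "v \<in> carrier G" "k \<in> carrier G" "c \<in> carrier G" "d \<in> carrier G" "a \<in> carrier G"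
    "b \<in> carrier G" "v \<otimes> (d \<otimes> b) = c \<otimes> (a \<otimes> k)"
  shows "v \<otimes> inv k = (c \<otimes> inv d) \<otimes> (a \<otimes> inv b)"
proof -
  have "v = c \<otimes> (a \<otimes> k) \<otimes> inv (d \<otimes> b)"
    using assms by (simp add: inv_solve_right)
  also have "\<dots> = (c \<otimes> inv d) \<otimes> (a \<otimes> inv b) \<otimes> k"
    using assms by (simp add: inv_mult m_ac)
  finally show ?thesis
    using assms by (simp add: m_assoc)
qed

text \<open>Links triviality of the pairing to the symmetry
  \<open>\<mu> (s, t) = \<mu> (t, s)\<close> between elements of \<open>S\<close> and
  \<open>T\<close>.\<close>

lemma (in comm_group) mult_inv_eq_one_iff:
  assumes "a \<in> carrier G" "b \<in> carrier G"
  shows "a \<otimes> inv b = \<one> \<longleftrightarrow> a = b"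
  using assms by (metis inv_closed inv_equality inv_inv r_inv)

text \<open>The identity of the quotient is \<open>H\<close> itself, and \<open>H #> x\<close>
  equals \<open>H\<close> exactly when \<open>x\<close> lies in \<open>H\<close>.\<close>

lemma (in normal) kernel_r_coset: "kernel G (G Mod H) (\<lambda>x. H #> x) = H"
  using coset_join1[OF _ _ is_subgroup] coset_join2[OF _ is_subgroup] subset
  by (auto simp: kernel_def)

section \<open>Cohomology classes\<close>

lemma normal_B2:
  assumes "monoid S" "comm_group \<Gamma>"
  shows "B2 S \<Gamma> \<lhd> Z2 S \<Gamma>"
  using comm_group.subgroup_imp_normal[OF comm_group_Z2 subgroup_B2] assms by blast

lemma H2_class_hom:
  assumes "monoid S" "comm_group \<Gamma>"
  shows "H2_class S \<Gamma> \<in> hom (Z2 S \<Gamma>) (H2 S \<Gamma>)"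
  using normal.r_coset_hom_Mod[OF normal_B2[OF assms]] by (simp add: H2_class_def[abs_def] H2_def)

lemma H2_class_eq_one_iff:
  assumes "monoid S" "comm_group \<Gamma>" "\<mu> \<in> cocycles S \<Gamma>"
  shows "H2_class S \<Gamma> \<mu> = \<one>\<^bsub>H2 S \<Gamma>\<^esub> \<longleftrightarrow> \<mu> \<in> B2 S \<Gamma>"
  using normal.kernel_r_coset[OF normal_B2[OF assms(1,2)]] assms(3)
  by (auto simp: H2_class_def H2_def kernel_def)

lemma carrier_H2: "carrier (H2 S \<Gamma>) = H2_class S \<Gamma> ` cocycles S \<Gamma>"
  by (auto simp: H2_def H2_class_def FactGroup_def RCOSETS_def)

section \<open>The direct product with its inclusions and projections\<close>

locale monoid_pair = S: monoid S + T: monoid T + comm_group \<Gamma>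
  for S :: "('a, 'm) monoid_scheme" and T :: "('b, 'k) monoid_scheme"
    and \<Gamma> :: "('g, 'n) monoid_scheme" (structure)
begin

abbreviation "inS \<equiv> \<lambda>s. (s, \<one>\<^bsub>T\<^esub>)"
abbreviation "inT \<equiv> \<lambda>t. (\<one>\<^bsub>S\<^esub>, t)"

lemma monoid_ST: "monoid (S \<times>\<times> T)"
  by (rule DirProd_monoid) unfold_locales

lemma inS_hom: "inS \<in> hom S (S \<times>\<times> T)"
  by (auto simp: hom_def)

lemma inT_hom: "inT \<in> hom T (S \<times>\<times> T)"
  by (auto simp: hom_def)

lemma fst_hom: "fst \<in> hom (S \<times>\<times> T) S"
  by (auto simp: hom_def)

lemma snd_hom: "snd \<in> hom (S \<times>\<times> T) T"
  by (auto simp: hom_def)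

lemma restrict_left_eq: "restrict_left S T = pullback S inS"
  by (auto simp: restrict_left_def pullback_def)

lemma restrict_right_eq: "restrict_right S T = pullback T inT"
  by (auto simp: restrict_right_def pullback_def)

lemma restrict_left_hom: "restrict_left S T \<in> hom (Z2 (S \<times>\<times> T) \<Gamma>) (Z2 S \<Gamma>)"
  unfolding restrict_left_eq by (rule pullback_hom[OF S.monoid_axioms inS_hom]) simp

lemma restrict_right_hom: "restrict_right S T \<in> hom (Z2 (S \<times>\<times> T) \<Gamma>) (Z2 T \<Gamma>)"
  unfolding restrict_right_eq by (rule pullback_hom[OF T.monoid_axioms inT_hom]) simp

section \<open>Cocycle computations on the direct product\<close>

context
  fixes \<mu> assumes \<mu>: "\<mu> \<in> cocycles (S \<times>\<times> T) \<Gamma>"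
begin

lemma closed:
  "\<lbrakk>s \<in> carrier S; t \<in> carrier T; s' \<in> carrier S; t' \<in> carrier T\<rbrakk>
    \<Longrightarrow> \<mu> ((s, t), (s', t')) \<in> carrier \<Gamma>"
  by (rule cocycle_closed[OF \<mu>]) auto

text \<open>Products are spelled out in coordinates, so that the instances below, where some
  coordinates are identities, reduce by simplification.\<close>

lemma identity:
  assumes "s \<in> carrier S" "t \<in> carrier T" "s' \<in> carrier S" "t' \<in> carrier T"
    "s'' \<in> carrier S" "t'' \<in> carrier T"
  shows "\<mu> ((s, t), (s' \<otimes>\<^bsub>S\<^esub> s'', t' \<otimes>\<^bsub>T\<^esub> t'')) \<otimes> \<mu> ((s', t'), (s'', t''))
    = \<mu> ((s, t), (s', t')) \<otimes> \<mu> ((s \<otimes>\<^bsub>S\<^esub> s', t \<otimes>\<^bsub>T\<^esub> t'), (s'', t''))"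
  using cocycle_identity[OF \<mu>, of "(s, t)" "(s', t')" "(s'', t'')"] assms by simp

text \<open>Elements of \<open>S\<close> and \<open>T\<close> commute in the product, so the cocycle
  identities for the triples (s, s', t), (s, t, s') and (t, s, s') share the values
  \<open>m\<close>, \<open>p\<close> and \<open>w\<close>. Eliminating these three gives the
  claim.\<close>

lemma assoc_pairing_mult_left:
  assumes s: "s \<in> carrier S" "s' \<in> carrier S" "t \<in> carrier T"
  shows "\<mu> (inS (s \<otimes>\<^bsub>S\<^esub> s'), inT t) \<otimes> inv \<mu> (inT t, inS (s \<otimes>\<^bsub>S\<^esub> s'))
    = (\<mu> (inS s, inT t) \<otimes> inv \<mu> (inT t, inS s)) \<otimes> (\<mu> (inS s', inT t) \<otimes> inv \<mu> (inT t, inS s'))"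
proof (rule divide_eq_mult_divide)
  define m where "m = \<mu> (inS s, inS s')"
  define p where "p = \<mu> (inS s, (s', t))"
  define w where "w = \<mu> ((s, t), inS s')"
  define v where "v = \<mu> (inS (s \<otimes>\<^bsub>S\<^esub> s'), inT t)"
  define k where "k = \<mu> (inT t, inS (s \<otimes>\<^bsub>S\<^esub> s'))"
  define c where "c = \<mu> (inS s, inT t)"
  define d where "d = \<mu> (inT t, inS s)"
  define a where "a = \<mu> (inS s', inT t)"
  define b where "b = \<mu> (inT t, inS s')"
  note defs = m_def p_def w_def v_def k_def c_def d_def a_def b_def
  have G: "m \<in> carrier \<Gamma>" "p \<in> carrier \<Gamma>" "w \<in> carrier \<Gamma>" "v \<in> carrier \<Gamma>" "k \<in> carrier \<Gamma>"
    "c \<in> carrier \<Gamma>" "d \<in> carrier \<Gamma>" "a \<in> carrier \<Gamma>" "b \<in> carrier \<Gamma>"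
    using s by (auto simp: defs closed)
  have 1: "p \<otimes> a = m \<otimes> v"
    using identity[of s "\<one>\<^bsub>T\<^esub>" s' "\<one>\<^bsub>T\<^esub>" "\<one>\<^bsub>S\<^esub>" t] s by (simp add: defs)
  have 2: "p \<otimes> b = c \<otimes> w"
    using identity[of s "\<one>\<^bsub>T\<^esub>" "\<one>\<^bsub>S\<^esub>" t s' "\<one>\<^bsub>T\<^esub>"] s by (simp add: defs)
  have 3: "k \<otimes> m = d \<otimes> w"
    using identity[of "\<one>\<^bsub>S\<^esub>" t s "\<one>\<^bsub>T\<^esub>" s' "\<one>\<^bsub>T\<^esub>"] s by (simp add: defs)
  \<comment> \<open>The factor \<open>m\<close> is introduced so that identity 1 can replace
    \<open>m \<otimes> v\<close>; it is cancelled at the end.\<close>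
  have "m \<otimes> (v \<otimes> (d \<otimes> b)) = (m \<otimes> v) \<otimes> (d \<otimes> b)"
    using G by (simp add: m_ac)
  also have "\<dots> = (p \<otimes> b) \<otimes> (a \<otimes> d)"
    using G by (simp add: 1[symmetric] m_ac)
  also have "\<dots> = (d \<otimes> w) \<otimes> (c \<otimes> a)"
    using G by (simp add: 2 m_ac)
  also have "\<dots> = m \<otimes> (c \<otimes> (a \<otimes> k))"
    using G by (simp add: 3[symmetric] m_ac)
  finally show "v \<otimes> (d \<otimes> b) = c \<otimes> (a \<otimes> k)"
    using G Units_l_cancel[of m] by (simp add: Units_eq)
qed (use s in \<open>auto intro!: closed\<close>)

text \<open>The mirror image of the preceding argument, with the triples (t, t', s), (t, s, t') and
  (s, t, t').\<close>

lemma assoc_pairing_mult_right: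
  assumes s: "s \<in> carrier S" "t \<in> carrier T" "t' \<in> carrier T"
  shows "\<mu> (inS s, inT (t \<otimes>\<^bsub>T\<^esub> t')) \<otimes> inv \<mu> (inT (t \<otimes>\<^bsub>T\<^esub> t'), inS s)
    = (\<mu> (inS s, inT t) \<otimes> inv \<mu> (inT t, inS s)) \<otimes> (\<mu> (inS s, inT t') \<otimes> inv \<mu> (inT t', inS s))"
proof (rule divide_eq_mult_divide)
  define m where "m = \<mu> (inT t, inT t')"
  define p where "p = \<mu> (inT t, (s, t'))"
  define w where "w = \<mu> ((s, t), inT t')"
  define v where "v = \<mu> (inS s, inT (t \<otimes>\<^bsub>T\<^esub> t'))"
  define k where "k = \<mu> (inT (t \<otimes>\<^bsub>T\<^esub> t'), inS s)"
  define c where "c = \<mu> (inS s, inT t)"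
  define d where "d = \<mu> (inT t, inS s)"
  define a where "a = \<mu> (inS s, inT t')"
  define b where "b = \<mu> (inT t', inS s)"
  note defs = m_def p_def w_def v_def k_def c_def d_def a_def b_def
  have G: "m \<in> carrier \<Gamma>" "p \<in> carrier \<Gamma>" "w \<in> carrier \<Gamma>" "v \<in> carrier \<Gamma>" "k \<in> carrier \<Gamma>"
    "c \<in> carrier \<Gamma>" "d \<in> carrier \<Gamma>" "a \<in> carrier \<Gamma>" "b \<in> carrier \<Gamma>"
    using s by (auto simp: defs closed)
  have 1: "p \<otimes> b = m \<otimes> k"
    using identity[of "\<one>\<^bsub>S\<^esub>" t "\<one>\<^bsub>S\<^esub>" t' s "\<one>\<^bsub>T\<^esub>"] s by (simp add: defs)
  have 2: "p \<otimes> a = d \<otimes> w"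
    using identity[of "\<one>\<^bsub>S\<^esub>" t s "\<one>\<^bsub>T\<^esub>" "\<one>\<^bsub>S\<^esub>" t'] s by (simp add: defs)
  have 3: "v \<otimes> m = c \<otimes> w"
    using identity[of s "\<one>\<^bsub>T\<^esub>" "\<one>\<^bsub>S\<^esub>" t "\<one>\<^bsub>S\<^esub>" t'] s by (simp add: defs)
  have "m \<otimes> (v \<otimes> (d \<otimes> b)) = (v \<otimes> m) \<otimes> (d \<otimes> b)"
    using G by (simp add: m_ac)
  also have "\<dots> = (d \<otimes> w) \<otimes> (c \<otimes> b)"
    using G by (simp add: 3 m_ac)
  also have "\<dots> = (p \<otimes> b) \<otimes> (c \<otimes> a)"
    using G by (simp add: 2[symmetric] m_ac)
  also have "\<dots> = m \<otimes> (c \<otimes> (a \<otimes> k))"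
    using G by (simp add: 1 m_ac)
  finally show "v \<otimes> (d \<otimes> b) = c \<otimes> (a \<otimes> k)"
    using G Units_l_cancel[of m] by (simp add: Units_eq)
qed (use s in \<open>auto intro!: closed\<close>)

lemma assoc_pairing_in_pairings: "assoc_pairing S T \<Gamma> \<mu> \<in> pairings S T \<Gamma>"
  unfolding pairings_def
  by (auto simp: assoc_pairing_def closed assoc_pairing_mult_left assoc_pairing_mult_right)

text \<open>The formula for \<open>\<mu>\<close> in the introduction, with denominators cleared so that no inverse occurs.\<close>

lemma normal_form:
  assumes s: "s \<in> carrier S" "t \<in> carrier T" "s' \<in> carrier S" "t' \<in> carrier T"
  shows "\<mu> ((s, t), (s', t')) \<otimes> (\<mu> (inS s, inT t) \<otimes> \<mu> (inS s', inT t') \<otimes> \<mu> (inS s', inT t))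
    = \<mu> (inS s, inS s') \<otimes> \<mu> (inT t, inT t') \<otimes> \<mu> (inT t, inS s')
        \<otimes> \<mu> (inS (s \<otimes>\<^bsub>S\<^esub> s'), inT (t \<otimes>\<^bsub>T\<^esub> t'))"
proof -
  define x where "x = \<mu> ((s, t), (s', t'))"
  define c where "c = \<mu> (inS s, inT t)"
  define d where "d = \<mu> (inS s', inT t')"
  define l where "l = \<mu> (inS s', inT t)"
  define r where "r = \<mu> (inS s, inS s')"
  define u where "u = \<mu> (inT t, inT t')"
  define m where "m = \<mu> (inT t, inS s')"
  define q where "q = \<mu> (inS (s \<otimes>\<^bsub>S\<^esub> s'), inT (t \<otimes>\<^bsub>T\<^esub> t'))"
  \<comment> \<open>The values \<open>p\<close>, \<open>a\<close>, \<open>b\<close> and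
    \<open>k\<close> do not occur in the claim. The cocycle identities for (s, t, s't'), (t, s',
    t'), (s', t, t') and (s, s', tt') are chained so that each is substituted away without any
    cancellation.\<close>
  define p where "p = \<mu> (inS s, (s', t \<otimes>\<^bsub>T\<^esub> t'))"
  define a where "a = \<mu> (inT t, (s', t'))"
  define b where "b = \<mu> ((s', t), inT t')"
  define k where "k = \<mu> (inS s', inT (t \<otimes>\<^bsub>T\<^esub> t'))"
  note defs = x_def c_def d_def l_def r_def u_def m_def q_def p_def a_def b_def k_def
  have G: "x \<in> carrier \<Gamma>" "c \<in> carrier \<Gamma>" "d \<in> carrier \<Gamma>" "l \<in> carrier \<Gamma>" "r \<in> carrier \<Gamma>"
    "u \<in> carrier \<Gamma>" "m \<in> carrier \<Gamma>" "q \<in> carrier \<Gamma>" "p \<in> carrier \<Gamma>" "a \<in> carrier \<Gamma>"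
    "b \<in> carrier \<Gamma>" "k \<in> carrier \<Gamma>"
    using s by (auto simp: defs closed)
  have 1: "p \<otimes> a = c \<otimes> x"
    using identity[of s "\<one>\<^bsub>T\<^esub>" "\<one>\<^bsub>S\<^esub>" t s' t'] s by (simp add: defs)
  have 2: "a \<otimes> d = m \<otimes> b"
    using identity[of "\<one>\<^bsub>S\<^esub>" t s' "\<one>\<^bsub>T\<^esub>" "\<one>\<^bsub>S\<^esub>" t'] s by (simp add: defs)
  have 3: "k \<otimes> u = l \<otimes> b"
    using identity[of s' "\<one>\<^bsub>T\<^esub>" "\<one>\<^bsub>S\<^esub>" t "\<one>\<^bsub>S\<^esub>" t'] s by (simp add: defs)
  have 4: "p \<otimes> k = r \<otimes> q"
    using identity[of s "\<one>\<^bsub>T\<^esub>" s' "\<one>\<^bsub>T\<^esub>" "\<one>\<^bsub>S\<^esub>" "t \<otimes>\<^bsub>T\<^esub> t'"] s by (simp add: defs)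
  have "x \<otimes> (c \<otimes> d \<otimes> l) = (c \<otimes> x) \<otimes> (d \<otimes> l)"
    using G by (simp add: m_ac)
  also have "\<dots> = (a \<otimes> d) \<otimes> (p \<otimes> l)"
    using G by (simp add: 1[symmetric] m_ac)
  also have "\<dots> = (l \<otimes> b) \<otimes> (p \<otimes> m)"
    using G by (simp add: 2 m_ac)
  also have "\<dots> = (p \<otimes> k) \<otimes> (u \<otimes> m)"
    using G by (simp add: 3[symmetric] m_ac)
  also have "\<dots> = r \<otimes> u \<otimes> m \<otimes> q"
    using G by (simp add: 4 m_ac)
  finally show ?thesis
    by (simp add: defs)
qed

text \<open>By \<open>triv\<close>, \<open>\<mu> (inS s', inT t)\<close> and
  \<open>\<mu> (inT t, inS s')\<close> agree, so they cancel from the two sides of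
  \<open>normal_form\<close>. The rest is a product of coboundary expressions in \<open>f\<close>,
  \<open>g\<close> and the mixed values \<open>\<mu> (inS s, inT t)\<close>.\<close>

lemma coboundary_if_trivial_factors:
  assumes f: "f \<in> carrier S \<rightarrow> carrier \<Gamma>" "f \<one>\<^bsub>S\<^esub> = \<one>" "restrict_left S T \<mu> = coboundary S \<Gamma> f"
    and g: "g \<in> carrier T \<rightarrow> carrier \<Gamma>" "g \<one>\<^bsub>T\<^esub> = \<one>" "restrict_right S T \<mu> = coboundary T \<Gamma> g"
    and triv: "assoc_pairing S T \<Gamma> \<mu> = \<one>\<^bsub>pairing_group S T \<Gamma>\<^esub>"
  shows "\<mu> \<in> B2 (S \<times>\<times> T) \<Gamma>"
proof -
  have fc: "f s \<in> carrier \<Gamma>" if "s \<in> carrier S" for s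
    using f that by auto
  have gc: "g t \<in> carrier \<Gamma>" if "t \<in> carrier T" for t
    using g that by auto
  \<comment> \<open>The coboundary of \<open>f s \<otimes> g t\<close> alone is one at
    \<open>(inS s, inT t)\<close>; dividing by the mixed value of \<open>\<mu>\<close> corrects it
    there.\<close>
  define h where "h = (\<lambda>(s, t). f s \<otimes> g t \<otimes> inv \<mu> (inS s, inT t))"
  have h: "h \<in> carrier (S \<times>\<times> T) \<rightarrow> carrier \<Gamma>"
    by (auto simp: h_def fc gc closed)
  have h1: "h \<one>\<^bsub>S \<times>\<times> T\<^esub> = \<one>"
    using cocycle_one[OF \<mu>, of "\<one>\<^bsub>S \<times>\<times> T\<^esub>"] by (simp add: h_def f g)
  have "\<mu> = coboundary (S \<times>\<times> T) \<Gamma> h"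
  proof (rule cocycle_ext[OF \<mu> coboundary_in_cocycles[OF monoid_ST comm_group_axioms h h1]])
    fix x y assume "x \<in> carrier (S \<times>\<times> T)" "y \<in> carrier (S \<times>\<times> T)"
    then obtain s t s' t' where xy: "x = (s, t)" "y = (s', t')"
      and s: "s \<in> carrier S" "t \<in> carrier T" "s' \<in> carrier S" "t' \<in> carrier T"
      by auto
    define c where "c = \<mu> (inS s, inT t)"
    define d where "d = \<mu> (inS s', inT t')"
    define l where "l = \<mu> (inS s', inT t)"
    define q where "q = \<mu> (inS (s \<otimes>\<^bsub>S\<^esub> s'), inT (t \<otimes>\<^bsub>T\<^esub> t'))"
    have l: "\<mu> (inT t, inS s') = l"
      using fun_cong[OF triv, of "(s', t)"] s
      by (simp add: l_def assoc_pairing_def one_pairing_group closed mult_inv_eq_one_iff)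
    have r: "\<mu> (inS s, inS s') = f s \<otimes> f s' \<otimes> inv f (s \<otimes>\<^bsub>S\<^esub> s')"
      using fun_cong[OF f(3), of "(s, s')"] s by (simp add: restrict_left_def coboundary_def)
    have u: "\<mu> (inT t, inT t') = g t \<otimes> g t' \<otimes> inv g (t \<otimes>\<^bsub>T\<^esub> t')"
      using fun_cong[OF g(3), of "(t, t')"] s by (simp add: restrict_right_def coboundary_def)
    have G: "c \<in> carrier \<Gamma>" "d \<in> carrier \<Gamma>" "l \<in> carrier \<Gamma>" "q \<in> carrier \<Gamma>"
      using s by (auto simp: c_def d_def l_def q_def closed)
    have X: "\<mu> (x, y) \<in> carrier \<Gamma>"
      using s xy by (simp add: closed)
    let ?r = "f s \<otimes> f s' \<otimes> inv f (s \<otimes>\<^bsub>S\<^esub> s')" and ?u = "g t \<otimes> g t' \<otimes> inv g (t \<otimes>\<^bsub>T\<^esub> t')"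
    have ru: "?r \<in> carrier \<Gamma>" "?u \<in> carrier \<Gamma>"
      using s fc gc by auto
    have "\<mu> (x, y) \<otimes> (c \<otimes> d \<otimes> l) = ?r \<otimes> ?u \<otimes> l \<otimes> q"
      using normal_form[OF s]
      by (simp only: xy l r u flip: c_def d_def l_def q_def)
    then have "l \<otimes> (\<mu> (x, y) \<otimes> (c \<otimes> d)) = l \<otimes> (?r \<otimes> ?u \<otimes> q)"
      using G X ru by (simp add: m_ac)
    then have "\<mu> (x, y) \<otimes> (c \<otimes> d) = ?r \<otimes> ?u \<otimes> q"
      using G X ru Units_l_cancel[of l] by (simp only: Units_eq m_closed)
    then have "\<mu> (x, y) = ?r \<otimes> ?u \<otimes> q \<otimes> inv (c \<otimes> d)"
      using G X ru by (simp add: inv_solve_right del: inv_mult_group)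
    also have "\<dots> = (f s \<otimes> g t \<otimes> inv c) \<otimes> (f s' \<otimes> g t' \<otimes> inv d)
        \<otimes> inv (f (s \<otimes>\<^bsub>S\<^esub> s') \<otimes> g (t \<otimes>\<^bsub>T\<^esub> t') \<otimes> inv q)"
      using G s fc gc by (simp add: inv_mult m_ac)
    also have "\<dots> = coboundary (S \<times>\<times> T) \<Gamma> h (x, y)"
      using s by (simp add: xy coboundary_def h_def c_def d_def q_def)
    finally show "\<mu> (x, y) = coboundary (S \<times>\<times> T) \<Gamma> h (x, y)" .
  qed
  then show ?thesis
    using h h1 by (auto simp: B2_def)
qed

end

section \<open>The pairing of products and coboundaries, and surjectivity on cocycles\<close>

lemma assoc_pairing_hom:
  "assoc_pairing S T \<Gamma> \<in> hom (Z2 (S \<times>\<times> T) \<Gamma>) (pairing_group S T \<Gamma>)"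
proof (rule homI)
  fix \<mu> \<nu> assume "\<mu> \<in> carrier (Z2 (S \<times>\<times> T) \<Gamma>)" "\<nu> \<in> carrier (Z2 (S \<times>\<times> T) \<Gamma>)"
  then show "assoc_pairing S T \<Gamma> (\<mu> \<otimes>\<^bsub>Z2 (S \<times>\<times> T) \<Gamma>\<^esub> \<nu>)
      = assoc_pairing S T \<Gamma> \<mu> \<otimes>\<^bsub>pairing_group S T \<Gamma>\<^esub> assoc_pairing S T \<Gamma> \<nu>"
    by (auto simp: mult_Z2 mult_pairing_group assoc_pairing_def closed inv_mult m_ac
        intro!: restrict_ext)
qed (simp add: assoc_pairing_in_pairings)

text \<open>Since \<open>inS s\<close> and \<open>inT t\<close> commute and \<Gamma> is abelian, a
  coboundary takes the same value on them in either order.\<close>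

lemma assoc_pairing_coboundary:
  assumes "b \<in> B2 (S \<times>\<times> T) \<Gamma>"
  shows "assoc_pairing S T \<Gamma> b = \<one>\<^bsub>pairing_group S T \<Gamma>\<^esub>"
proof -
  obtain h where h: "h \<in> carrier (S \<times>\<times> T) \<rightarrow> carrier \<Gamma>" and b: "b = coboundary (S \<times>\<times> T) \<Gamma> h"
    using assms by (auto simp: B2_def)
  have "h (s, t) \<in> carrier \<Gamma>" if "s \<in> carrier S" "t \<in> carrier T" for s t
    using h that by auto
  then show ?thesis
    unfolding b assoc_pairing_def one_pairing_group
    by (intro restrict_ext) (auto simp: coboundary_def mult_inv_eq_one_iff m_comm)
qed

lemma yamazaki_surj:
  assumes \<sigma>: "\<sigma> \<in> cocycles S \<Gamma>" and \<tau>: "\<tau> \<in> cocycles T \<Gamma>" and \<alpha>: "\<alpha> \<in> pairings S T \<Gamma>"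
  obtains \<mu> where "\<mu> \<in> cocycles (S \<times>\<times> T) \<Gamma>" "yamazaki S T \<Gamma> \<mu> = (\<sigma>, \<tau>, \<alpha>)"
proof -
  interpret Z: comm_group "Z2 (S \<times>\<times> T) \<Gamma>" by (rule comm_group_Z2[OF monoid_ST comm_group_axioms])
  note one = pairing_one[OF S.monoid_axioms T.monoid_axioms is_group \<alpha>]
  \<comment> \<open>Both sides of the cocycle identity for \<open>\<beta>\<close> expand to
    \<alpha>(s, t') \<alpha>(s, t'') \<alpha>(s', t''). Taking the \<open>S\<close>-part of the
    first argument and the \<open>T\<close>-part of the second makes \<beta>(s, t) = \<alpha>(s, t)
    and \<beta>(t, s) = 1, so the associated pairing is \<open>\<alpha>\<close> and not its
    inverse.\<close>
  define \<beta> where "\<beta> = (\<lambda>(x, y)\<in>carrier (S \<times>\<times> T) \<times> carrier (S \<times>\<times> T). \<alpha> (fst x, snd y))"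
  have \<beta>: "\<beta> \<in> cocycles (S \<times>\<times> T) \<Gamma>"
    unfolding cocycles_def
    by (auto simp: \<beta>_def pairing_closed[OF \<alpha>] pairing_mult[OF \<alpha>] one m_ac)
  \<comment> \<open>Each pullback is trivial on the other factor and, by normalization, on mixed
    pairs; so the three factors of \<open>\<mu>\<close> do not disturb one another.\<close>
  define \<mu> where
    "\<mu> = pullback (S \<times>\<times> T) fst \<sigma> \<otimes>\<^bsub>Z2 (S \<times>\<times> T) \<Gamma>\<^esub> pullback (S \<times>\<times> T) snd \<tau> \<otimes>\<^bsub>Z2 (S \<times>\<times> T) \<Gamma>\<^esub> \<beta>"
  have "\<mu> \<in> carrier (Z2 (S \<times>\<times> T) \<Gamma>)"
    unfolding \<mu>_def using \<beta> pullback_cocycle[OF monoid_ST fst_hom _ \<sigma>]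
      pullback_cocycle[OF monoid_ST snd_hom _ \<tau>]
    by (intro Z.m_closed) auto
  then have \<mu>: "\<mu> \<in> cocycles (S \<times>\<times> T) \<Gamma>"
    by simp
  have \<mu>_eq: "\<mu> ((s, t), (s', t')) = \<sigma> (s, s') \<otimes> \<tau> (t, t') \<otimes> \<alpha> (s, t')"
    if "s \<in> carrier S" "t \<in> carrier T" "s' \<in> carrier S" "t' \<in> carrier T" for s t s' t'
    using that by (simp add: \<mu>_def \<beta>_def mult_Z2)
  note simps = restrict_left_def restrict_right_def assoc_pairing_def \<mu>_eq one
    cocycle_one[OF \<sigma>] cocycle_one[OF \<tau>] pairing_closed[OF \<alpha>] cocycle_closed[OF \<sigma>]
    cocycle_closed[OF \<tau>]
  have "restrict_left S T \<mu> = \<sigma>"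
    by (rule cocycle_ext[OF _ \<sigma>]) (use \<mu> restrict_left_hom in \<open>auto simp: simps hom_def\<close>)
  moreover have "restrict_right S T \<mu> = \<tau>"
    by (rule cocycle_ext[OF _ \<tau>]) (use \<mu> restrict_right_hom in \<open>auto simp: simps hom_def\<close>)
  moreover have "assoc_pairing S T \<Gamma> \<mu> = \<alpha>"
    by (rule PiE_ext[of _ "carrier S \<times> carrier T" "\<lambda>_. carrier \<Gamma>"])
       (use assoc_pairing_in_pairings[OF \<mu>] \<alpha> in \<open>auto simp: pairings_def simps\<close>)
  ultimately show ?thesis
    using that[OF \<mu>] by (simp add: yamazaki_def)
qed

section \<open>The map from cocycles to classes: kernel and image\<close>

definition yamazaki_class where
  "yamazaki_class \<mu> = (H2_class S \<Gamma> (restrict_left S T \<mu>),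
     H2_class T \<Gamma> (restrict_right S T \<mu>), assoc_pairing S T \<Gamma> \<mu>)"

lemma yamazaki_class_hom:
  "yamazaki_class \<in> hom (Z2 (S \<times>\<times> T) \<Gamma>) (H2 S \<Gamma> \<times>\<times> (H2 T \<Gamma> \<times>\<times> pairing_group S T \<Gamma>))"
  using restrict_left_hom H2_class_hom[OF S.monoid_axioms comm_group_axioms]
    restrict_right_hom H2_class_hom[OF T.monoid_axioms comm_group_axioms] assoc_pairing_hom
  by (simp add: hom_def Pi_iff yamazaki_class_def)

text \<open>That coboundaries lie in the kernel makes the induced map on classes well defined; the
  reverse inclusion makes it injective.\<close>

lemma kernel_yamazaki_class:
  "kernel (Z2 (S \<times>\<times> T) \<Gamma>) (H2 S \<Gamma> \<times>\<times> (H2 T \<Gamma> \<times>\<times> pairing_group S T \<Gamma>)) yamazaki_class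
    = B2 (S \<times>\<times> T) \<Gamma>"
proof -
  have "yamazaki_class \<mu> = \<one>\<^bsub>H2 S \<Gamma> \<times>\<times> (H2 T \<Gamma> \<times>\<times> pairing_group S T \<Gamma>)\<^esub>
      \<longleftrightarrow> \<mu> \<in> B2 (S \<times>\<times> T) \<Gamma>" (is "?l \<longleftrightarrow> ?r")
    if \<mu>: "\<mu> \<in> cocycles (S \<times>\<times> T) \<Gamma>" for \<mu>
  proof -
    have "restrict_left S T \<mu> \<in> cocycles S \<Gamma>" "restrict_right S T \<mu> \<in> cocycles T \<Gamma>"
      using \<mu> restrict_left_hom restrict_right_hom by (auto simp: hom_def)
    then have "?l \<longleftrightarrow> restrict_left S T \<mu> \<in> B2 S \<Gamma> \<and> restrict_right S T \<mu> \<in> B2 T \<Gamma>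
        \<and> assoc_pairing S T \<Gamma> \<mu> = \<one>\<^bsub>pairing_group S T \<Gamma>\<^esub>"
      by (simp add: yamazaki_class_def H2_class_eq_one_iff S.monoid_axioms T.monoid_axioms
          comm_group_axioms)
    also have "\<dots> \<longleftrightarrow> ?r"
    proof
      assume "restrict_left S T \<mu> \<in> B2 S \<Gamma> \<and> restrict_right S T \<mu> \<in> B2 T \<Gamma>
        \<and> assoc_pairing S T \<Gamma> \<mu> = \<one>\<^bsub>pairing_group S T \<Gamma>\<^esub>"
      then show ?r
        \<comment> \<open>Only the coboundary groups of the two factors are unfolded, to obtain
          \<open>f\<close> and \<open>g\<close>; the one of the product stays folded in the
          goal.\<close>
        unfolding B2_def[of S] B2_def[of T]
        using coboundary_if_trivial_factors[OF \<mu>] by blast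
    next
      assume b: ?r
      then show "restrict_left S T \<mu> \<in> B2 S \<Gamma> \<and> restrict_right S T \<mu> \<in> B2 T \<Gamma>
          \<and> assoc_pairing S T \<Gamma> \<mu> = \<one>\<^bsub>pairing_group S T \<Gamma>\<^esub>"
        unfolding restrict_left_eq restrict_right_eq
        using pullback_coboundary[OF S.monoid_axioms inS_hom _ b]
          pullback_coboundary[OF T.monoid_axioms inT_hom _ b] assoc_pairing_coboundary[OF b]
        by simp
    qed
    finally show ?thesis .
  qed
  moreover have "B2 (S \<times>\<times> T) \<Gamma> \<subseteq> cocycles (S \<times>\<times> T) \<Gamma>"
    using subgroup.subset[OF subgroup_B2[OF monoid_ST comm_group_axioms]] by simp
  ultimately show ?thesis
    by (auto simp: kernel_def)
qed

lemma yamazaki_class_surj: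
  "yamazaki_class ` carrier (Z2 (S \<times>\<times> T) \<Gamma>)
    = carrier (H2 S \<Gamma> \<times>\<times> (H2 T \<Gamma> \<times>\<times> pairing_group S T \<Gamma>))"
proof
  show "yamazaki_class ` carrier (Z2 (S \<times>\<times> T) \<Gamma>)
      \<subseteq> carrier (H2 S \<Gamma> \<times>\<times> (H2 T \<Gamma> \<times>\<times> pairing_group S T \<Gamma>))"
    using hom_carrier[OF yamazaki_class_hom] .
  show "carrier (H2 S \<Gamma> \<times>\<times> (H2 T \<Gamma> \<times>\<times> pairing_group S T \<Gamma>))
      \<subseteq> yamazaki_class ` carrier (Z2 (S \<times>\<times> T) \<Gamma>)"
  proof
    fix z assume "z \<in> carrier (H2 S \<Gamma> \<times>\<times> (H2 T \<Gamma> \<times>\<times> pairing_group S T \<Gamma>))"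
    then obtain \<sigma> \<tau> \<alpha> where "\<sigma> \<in> cocycles S \<Gamma>" "\<tau> \<in> cocycles T \<Gamma>" "\<alpha> \<in> pairings S T \<Gamma>"
      and z: "z = (H2_class S \<Gamma> \<sigma>, H2_class T \<Gamma> \<tau>, \<alpha>)"
      by (auto simp: carrier_H2)
    then obtain \<mu> where "\<mu> \<in> cocycles (S \<times>\<times> T) \<Gamma>" "yamazaki S T \<Gamma> \<mu> = (\<sigma>, \<tau>, \<alpha>)"
      using yamazaki_surj by blast
    then show "z \<in> yamazaki_class ` carrier (Z2 (S \<times>\<times> T) \<Gamma>)"
      by (auto simp: z yamazaki_class_def yamazaki_def intro!: image_eqI[of _ _ \<mu>])
  qed
qed

end

section \<open>Passage to cohomology by the first isomorphism theorem\<close>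

theorem theorem2p4:
  fixes S :: "('a, 'm) monoid_scheme"
    and T :: "('b, 'k) monoid_scheme"
    and \<Gamma> :: "('g, 'n) monoid_scheme"
  assumes "monoid S" and "monoid T" and "comm_group \<Gamma>"
  shows "yamazaki S T \<Gamma> \<in> carrier (Z2 (S \<times>\<times> T) \<Gamma>)
           \<rightarrow> carrier (Z2 S \<Gamma>) \<times> carrier (Z2 T \<Gamma>) \<times> carrier (pairing_group S T \<Gamma>)
       \<and> (\<exists>\<Phi> \<in> iso (H2 (S \<times>\<times> T) \<Gamma>) (H2 S \<Gamma> \<times>\<times> (H2 T \<Gamma> \<times>\<times> pairing_group S T \<Gamma>)).
            \<forall>\<mu> \<in> carrier (Z2 (S \<times>\<times> T) \<Gamma>).
              \<Phi> (H2_class (S \<times>\<times> T) \<Gamma> \<mu>) =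
                (case yamazaki S T \<Gamma> \<mu> of (\<mu>S, \<mu>T, \<alpha>) \<Rightarrow>
                   (H2_class S \<Gamma> \<mu>S, H2_class T \<Gamma> \<mu>T, \<alpha>)))"
proof -
  interpret monoid_pair S T \<Gamma>
    using assms by (simp add: monoid_pair_def)
  let ?Z = "Z2 (S \<times>\<times> T) \<Gamma>" and ?K = "H2 S \<Gamma> \<times>\<times> (H2 T \<Gamma> \<times>\<times> pairing_group S T \<Gamma>)"
  \<comment> \<open>\<open>yamazaki_class\<close> is constant on each coset of its kernel, so the
    image of a class is a singleton and \<open>the_elem\<close> extracts its value.
    \<open>FactGroup_iso_set\<close> provides the isomorphism in this form.\<close>
  let ?\<Phi> = "\<lambda>X. the_elem (yamazaki_class ` X)"
  have groups: "group ?Z" "group ?K"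
    using comm_group_Z2[OF monoid_ST assms(3)] comm_group_H2[OF assms(1,3)]
      comm_group_H2[OF assms(2,3)] comm_group_pairing_group[OF assms]
    by (auto intro!: DirProd_group intro: comm_group.axioms(2))
  interpret h: group_hom ?Z ?K yamazaki_class
    using groups yamazaki_class_hom by (simp add: group_hom_def group_hom_axioms_def)
  have iso: "?\<Phi> \<in> iso (H2 (S \<times>\<times> T) \<Gamma>) ?K"
    using h.FactGroup_iso_set[OF yamazaki_class_surj] by (simp add: kernel_yamazaki_class flip: H2_def)
  have "?\<Phi> (H2_class (S \<times>\<times> T) \<Gamma> \<mu>) = yamazaki_class \<mu>" if \<mu>: "\<mu> \<in> carrier ?Z" for \<mu>
  proof -
    \<comment> \<open>The isomorphism is given through images of cosets; its value on the class of
      \<open>\<mu>\<close> follows because every coboundary is sent to the identity.\<close>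
    have "yamazaki_class (b \<otimes>\<^bsub>?Z\<^esub> \<mu>) = yamazaki_class \<mu>" if "b \<in> B2 (S \<times>\<times> T) \<Gamma>" for b
    proof -
      have "b \<in> carrier ?Z" "yamazaki_class b = \<one>\<^bsub>?K\<^esub>"
        using that unfolding kernel_yamazaki_class[symmetric] kernel_def by auto
      then show ?thesis
        using \<mu> h.hom_mult h.hom_closed h.H.l_one by metis
    qed
    \<comment> \<open>Without an element of the coset its image would be empty instead of a
      singleton.\<close>
    moreover have "B2 (S \<times>\<times> T) \<Gamma> \<noteq> {}"
      using subgroup.one_closed[OF subgroup_B2[OF monoid_ST assms(3)]] by blast
    ultimately have "yamazaki_class ` H2_class (S \<times>\<times> T) \<Gamma> \<mu> = {yamazaki_class \<mu>}"
      by (auto simp: H2_class_def r_coset_def image_UN)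
    then show ?thesis
      by simp
  qed
  moreover have "yamazaki S T \<Gamma> \<in> carrier ?Z
      \<rightarrow> carrier (Z2 S \<Gamma>) \<times> carrier (Z2 T \<Gamma>) \<times> carrier (pairing_group S T \<Gamma>)"
    using restrict_left_hom restrict_right_hom assoc_pairing_hom
    by (auto simp: yamazaki_def hom_def)
  ultimately show ?thesis
    using iso by (auto simp: yamazaki_class_def yamazaki_def intro!: bexI[of _ ?\<Phi>])
qed

end
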